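(* Let $D<\omega$ and let $\mathcal{C}$ be a family of Borel subsets of $\mathbb{R}^2$ of $D$-bounded alternation. For every $\epsilon>0$ there is an $\mathcal{L}$-formula $\varphi(x,y;\overline{z},\overline{w})$ without additional parameters (depending only on $D$ and $\epsilon$) such that for all Borel probability measures $\mu_0,\mu_1$ on $\mathbb{R}$ and every $C\in\mathcal{C}$ there are parameters $\overline{a}\in\mathbb{R}^{|\overline{z}|+|\overline{w}|}$ with $(\mu_0\otimes\mu_1)\bigl(\varphi(\mathbb{R}^2;\overline{a})\triangle C\bigr)<\epsilon$. Moreover, there is an integer $m$ with $|\overline{z}|=2m$ and $|\overline{w}|=m^2$ such that, given $\mu_0,\mu_1$, there is an $m\times m$ grid $\Gamma=\{(a_i,b_j):i,j<m\}\subseteq\mathbb{R}^2$ such that for every $C\in\mathcal{C}$ the defining parameters can be taken with $\overline{z}$ filled by $a_0,\dots,a_{m-1},b_0,\dots,b_{m-1}$ and $\overline{w}$ filled by elements of $\{0,1\}$.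
   Context: $\mathcal{L}=\{+,\times,-,0,1,<\}$ is the language of ordered rings, interpreted in the real field $(\mathbb{R};+,\times,-,0,1,<)$; $\varphi(\mathbb{R}^2;\overline{a})=\{(x,y)\in\mathbb{R}^2:\mathbb{R}\models\varphi(x,y;\overline{a})\}$. $\triangle$ denotes symmetric difference and $\mu_0\otimes\mu_1$ the product measure. A set $S\subseteq\mathbb{R}^2$ has at most $D$ alternations along an axis-parallel line $L$ if there is no sequence of points $p_0<p_1<\dots<p_{D+1}$ on $L$ (ordered along $L$) such that for each $t\le D$ exactly one of $p_t,p_{t+1}$ lies in $S$. A family $\mathcal{C}$ of subsets of $\mathbb{R}^2$ has $D$-bounded alternation if no element of $\mathcal{C}$ has more than $D$ alternations along any axis-parallel line. *)

theory Defs
  imports "HOL-Probability.Probability"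
begin

text \<open>First-order logic over the language of ordered rings, interpreted in the reals.
  The symbol \<open>-\<close> of the language is read as binary subtraction. Variables are named by
  natural numbers; the remaining connectives and the universal quantifier are definable.\<close>

datatype oterm =
    TVar nat
  | TZero
  | TOne
  | TAdd oterm oterm
  | TMul oterm oterm
  | TSub oterm oterm

datatype oform =
    FEq oterm oterm
  | FLess oterm oterm
  | FNot oform
  | FAnd oform oform
  | FEx nat oform

primrec tval :: "(nat \<Rightarrow> real) \<Rightarrow> oterm \<Rightarrow> real" where
  "tval e (TVar n) = e n"
| "tval e TZero = 0"
| "tval e TOne = 1"
| "tval e (TAdd s t) = tval e s + tval e t"
| "tval e (TMul s t) = tval e s * tval e t"
| "tval e (TSub s t) = tval e s - tval e t"

primrec sat :: "(nat \<Rightarrow> real) \<Rightarrow> oform \<Rightarrow> bool" where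
  "sat e (FEq s t) \<longleftrightarrow> tval e s = tval e t"
| "sat e (FLess s t) \<longleftrightarrow> tval e s < tval e t"
| "sat e (FNot p) \<longleftrightarrow> \<not> sat e p"
| "sat e (FAnd p q) \<longleftrightarrow> sat e p \<and> sat e q"
| "sat e (FEx n p) \<longleftrightarrow> (\<exists>v. sat (e(n := v)) p)"

primrec tvars :: "oterm \<Rightarrow> nat set" where
  "tvars (TVar n) = {n}"
| "tvars TZero = {}"
| "tvars TOne = {}"
| "tvars (TAdd s t) = tvars s \<union> tvars t"
| "tvars (TMul s t) = tvars s \<union> tvars t"
| "tvars (TSub s t) = tvars s \<union> tvars t"

primrec fvars :: "oform \<Rightarrow> nat set" where
  "fvars (FEq s t) = tvars s \<union> tvars t"
| "fvars (FLess s t) = tvars s \<union> tvars t"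
| "fvars (FNot p) = fvars p"
| "fvars (FAnd p q) = fvars p \<union> fvars q"
| "fvars (FEx n p) = fvars p - {n}"

text \<open>The value 0 beyond the end of the list is immaterial: it is only used for formulas
  whose free variables are all below the length of the list.\<close>

definition assign :: "real list \<Rightarrow> nat \<Rightarrow> real" where
  "assign vs n = (if n < length vs then vs ! n else 0)"

text \<open>A formula in the variables \<open>x, y; z, w\<close>, where \<open>z\<close> has length \<open>k\<close> and \<open>w\<close> has length
  \<open>l\<close>: variable 0 is \<open>x\<close>, variable 1 is \<open>y\<close>, the next \<open>k\<close> variables are \<open>z\<close>, and the
  \<open>l\<close> after them are \<open>w\<close>.\<close>

definition formula_in :: "nat \<Rightarrow> nat \<Rightarrow> oform \<Rightarrow> bool" where
  "formula_in k l \<phi> \<longleftrightarrow> fvars \<phi> \<subseteq> {..<2 + k + l}"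

definition defset :: "oform \<Rightarrow> real list \<Rightarrow> real list \<Rightarrow> (real \<times> real) set" where
  "defset \<phi> zs ws = {(x, y). sat (assign (x # y # zs @ ws)) \<phi>}"

definition axis_parallel_line :: "(real \<times> real) set \<Rightarrow> bool" where
  "axis_parallel_line L \<longleftrightarrow> (\<exists>c. L = {p. fst p = c}) \<or> (\<exists>c. L = {p. snd p = c})"

text \<open>For two points on a common axis-parallel line one coordinate agrees, so the following
  is the strict order along the line.\<close>

definition line_less :: "real \<times> real \<Rightarrow> real \<times> real \<Rightarrow> bool" where
  "line_less p q \<longleftrightarrow> fst p \<le> fst q \<and> snd p \<le> snd q \<and> p \<noteq> q"

definition at_most_alternations :: "nat \<Rightarrow> (real \<times> real) set \<Rightarrow> (real \<times> real) set \<Rightarrow> bool" where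
  "at_most_alternations D S L \<longleftrightarrow>
     \<not> (\<exists>p :: nat \<Rightarrow> real \<times> real.
          (\<forall>t\<le>D + 1. p t \<in> L) \<and>
          (\<forall>t\<le>D. line_less (p t) (p (t + 1))) \<and>
          (\<forall>t\<le>D. (p t \<in> S) \<noteq> (p (t + 1) \<in> S)))"

definition bounded_alternation :: "nat \<Rightarrow> (real \<times> real) set set \<Rightarrow> bool" where
  "bounded_alternation D \<C> \<longleftrightarrow>
     (\<forall>S\<in>\<C>. \<forall>L. axis_parallel_line L \<longrightarrow> at_most_alternations D S L)"

definition borel_prob :: "real measure \<Rightarrow> bool" where
  "borel_prob \<mu> \<longleftrightarrow> prob_space \<mu> \<and> sets \<mu> = sets borel"

text \<open>The measurability conjunct is there because \<^const>\<open>measure\<close> is 0 on non-measurable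
  sets. It excludes nothing mathematically: definable sets are semialgebraic, hence Borel.\<close>

definition symdiff_less ::
  "real measure \<Rightarrow> real measure \<Rightarrow> (real \<times> real) set \<Rightarrow> (real \<times> real) set \<Rightarrow> real \<Rightarrow> bool" where
  "symdiff_less \<mu>\<^sub>0 \<mu>\<^sub>1 A C \<epsilon> \<longleftrightarrow>
     sym_diff A C \<in> sets (\<mu>\<^sub>0 \<Otimes>\<^sub>M \<mu>\<^sub>1) \<and>
     measure (\<mu>\<^sub>0 \<Otimes>\<^sub>M \<mu>\<^sub>1) (sym_diff A C) < \<epsilon>"

text \<open>The coordinates are required to be pairwise distinct, so that the grid has \<open>m\<^sup>2\<close> points.\<close>

definition is_grid :: "nat \<Rightarrow> (nat \<Rightarrow> real) \<Rightarrow> (nat \<Rightarrow> real) \<Rightarrow> (real \<times> real) set \<Rightarrow> bool" where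
  "is_grid m a b \<Gamma> \<longleftrightarrow>
     inj_on a {..<m} \<and> inj_on b {..<m} \<and> \<Gamma> = {(a i, b j) | i j. i < m \<and> j < m}"

end

theory Submission
  imports Defs
begin

text \<open>
  Cut each axis at \<open>k\<close> points so that every class of the resulting partition is a single point or
  has measure at most \<open>1 / k\<close>; the cut points may be atoms, so they are classes of their own.
  A function on a line with at most \<open>D\<close> alternations is non-constant on at most \<open>D + 1\<close> classes.
  Hence, with an arbitrary representative \<open>x\<^sup>*\<close> of the class of \<open>x\<close>, membership
  of \<open>(x, y)\<close> and \<open>(x\<^sup>*, y)\<close> in \<open>C\<close> differs on a set of measure at most
  \<open>(D + 1) / k\<close> on every horizontal line, and likewise for \<open>(x\<^sup>*, y)\<close> and
  \<open>(x\<^sup>*, y\<^sup>*)\<close> on every vertical line. By Fubini, \<open>C\<close> is within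
  \<open>2 (D + 1) / k\<close> of a union of products of classes, whatever representatives are taken.
\<close>

section \<open>Classes of a cut line and their order patterns\<close>

text \<open>If \<open>a\<close> is increasing, the open gap below \<open>a r\<close> gets index \<open>2 * r\<close> and the point \<open>a r\<close>
  itself gets \<open>2 * r + 1\<close>.\<close>

definition cut_index :: "(nat \<Rightarrow> real) \<Rightarrow> nat \<Rightarrow> real \<Rightarrow> nat" where
  "cut_index a k x = (\<Sum>r<k. if a r < x then 2 else if a r = x then 1 else 0)"

lemma mono_cut_index: "mono (cut_index a k)"
  unfolding cut_index_def by (intro monoI sum_mono) auto

lemma borel_measurable_cut_index [measurable]:
  "cut_index a k \<in> borel \<rightarrow>\<^sub>M count_space UNIV"
  unfolding cut_index_def by measurable

text \<open>A cut between two points, or at one of them, raises its own summand, and no other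
  summand drops. Consequently a class containing a cut is a single point.\<close>

lemma cut_index_strict_mono:
  assumes "u \<le> a r" "a r \<le> v" "u < v" "r < k"
  shows "cut_index a k u < cut_index a k v"
  unfolding cut_index_def
proof (rule sum_strict_mono_ex1)
  show "\<exists>r\<in>{..<k}. (if a r < u then 2 else if a r = u then 1 else 0 :: nat)
      < (if a r < v then 2 else if a r = v then 1 else 0)"
    using assms by (intro bexI[where x = r]) auto
qed (use assms in auto)

text \<open>The condition \<open>cut_index a k x = i\<close> as a conjunction of order comparisons,
  the shape in which a formula can express it; \<open>cut_pattern_iff\<close> gives the equivalence
  for increasing cuts and \<open>i\<close> at most \<open>2 * k\<close>.\<close>

definition cut_pattern :: "(nat \<Rightarrow> real) \<Rightarrow> nat \<Rightarrow> nat \<Rightarrow> real \<Rightarrow> bool" where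
  "cut_pattern a k i x \<longleftrightarrow>
     (\<forall>r<k. if 2 * r + 1 < i then a r < x else if 2 * r + 1 = i then x = a r else x < a r)"

text \<open>The truncation by \<open>min\<close> lets the induction keep \<open>i\<close> fixed
  while the last cut is dropped, even where \<open>i\<close> exceeds \<open>2 * k\<close>.\<close>

lemma cut_pattern_imp_index:
  assumes "cut_pattern a k i x"
  shows "cut_index a k x = min i (2 * k)"
  using assms
proof (induction k)
  case 0
  then show ?case by (simp add: cut_index_def)
next
  case (Suc k)
  then have "cut_index a k x = min i (2 * k)"
    by (simp add: cut_pattern_def)
  moreover from Suc.prems
  have "if 2 * k + 1 < i then a k < x else if 2 * k + 1 = i then x = a k else x < a k"
    unfolding cut_pattern_def by blast
  ultimately show ?case
    by (auto simp: cut_index_def split: if_splits)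
qed

text \<open>Locate \<open>x\<close> relative to the last cut: above it the index is maximal, at it
  one less, and below it the index for the earlier cuts is kept.\<close>

lemma cut_pattern_exists:
  assumes "strict_mono_on {..<k} a"
  shows "\<exists>i\<le>2 * k. cut_pattern a k i x"
  using assms
proof (induction k)
  case 0
  then show ?case by (simp add: cut_pattern_def)
next
  case (Suc k)
  then obtain i where i: "i \<le> 2 * k" "cut_pattern a k i x"
    by (meson lessThan_iff less_Suc_eq strict_mono_on_def)
  consider "a k < x" | "a k = x" | "x < a k" by linarith
  then show ?case
  proof cases
    case 1
    then have "a r < x" if "r < Suc k" for r
      using strict_mono_onD[OF Suc.prems, of r k] that less_antisym by fastforce
    then show ?thesis
      by (intro exI[of _ "2 * Suc k"]) (auto simp: cut_pattern_def)
  next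
    case 2
    then have "a r < x" if "r < k" for r
      using strict_mono_onD[OF Suc.prems, of r k] that by simp
    with 2 show ?thesis
      by (intro exI[of _ "2 * k + 1"]) (auto simp: cut_pattern_def less_Suc_eq)
  next
    case 3
    with i show ?thesis
      by (intro exI[of _ i]) (auto simp: cut_pattern_def less_Suc_eq)
  qed
qed

lemma cut_pattern_iff:
  assumes "strict_mono_on {..<k} a" "i \<le> 2 * k"
  shows "cut_pattern a k i x \<longleftrightarrow> cut_index a k x = i"
proof
  assume "cut_pattern a k i x"
  then show "cut_index a k x = i" using cut_pattern_imp_index assms(2) by fastforce
next
  \<comment> \<open>Some pattern holds at \<open>x\<close>, and it determines the index, so it must
    be the pattern of \<open>i\<close>.\<close>
  assume "cut_index a k x = i"
  moreover obtain j where "j \<le> 2 * k" "cut_pattern a k j x"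
    using cut_pattern_exists[OF assms(1)] by blast
  ultimately show "cut_pattern a k i x"
    using cut_pattern_imp_index[of a k j x] by simp
qed

lemma cut_index_le:
  assumes "strict_mono_on {..<k} a"
  shows "cut_index a k x \<le> 2 * k"
proof -
  obtain i where "cut_pattern a k i x"
    using cut_pattern_exists[OF assms] by blast
  then show ?thesis by (simp add: cut_pattern_imp_index)
qed

section \<open>Bounded alternation leaves few mixed classes\<close>

text \<open>The chain is built downwards from a prescribed end point: a mixed level contains points with
  either value of \<open>g\<close>.\<close>

lemma alternating_chain:
  fixes idx :: "real \<Rightarrow> nat" and g :: "real \<Rightarrow> bool"
  assumes "mono idx" "finite V" "card V = n"
    and "\<And>v. v \<in> V \<Longrightarrow> v < idx y"
    and "\<And>v. v \<in> V \<Longrightarrow> \<exists>x x'. idx x = v \<and> idx x' = v \<and> g x \<noteq> g x'"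
  shows "\<exists>p. p n = y \<and> (\<forall>t<n. p t < p (Suc t) \<and> g (p t) \<noteq> g (p (Suc t)))"
  using assms(2-)
proof (induction n arbitrary: V y)
  case 0
  then show ?case by auto
next
  case (Suc n)
  define b where "b = Max V"
  have b: "b \<in> V" "\<And>v. v \<in> V \<Longrightarrow> v \<le> b"
    using Suc.prems(1,2) unfolding b_def by (auto intro!: Max_in)
  obtain z where z: "idx z = b" "g z \<noteq> g y"
    using Suc.prems(4)[OF b(1)] by metis
  have "z < y"
    using Suc.prems(3)[OF b(1)] z(1) monoD[OF \<open>mono idx\<close>, of y z] by linarith
  have "\<exists>p. p n = z \<and> (\<forall>t<n. p t < p (Suc t) \<and> g (p t) \<noteq> g (p (Suc t)))"
  proof (rule Suc.IH[of "V - {b}"])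
    show "v < idx z" if "v \<in> V - {b}" for v
      using that b z(1) by (auto simp: order_less_le)
  qed (use Suc.prems b in auto)
  then obtain p where "p n = z" "\<forall>t<n. p t < p (Suc t) \<and> g (p t) \<noteq> g (p (Suc t))"
    by blast
  with z \<open>z < y\<close> show ?case
    by (intro exI[of _ "p(Suc n := y)"]) (auto simp: less_Suc_eq)
qed

text \<open>One-dimensional form of \<open>at_most_alternations\<close>, for the trace of a planar
  set on a line parametrised by its free coordinate.\<close>

definition boundedly_alternating :: "nat \<Rightarrow> (real \<Rightarrow> bool) \<Rightarrow> bool" where
  "boundedly_alternating D g \<longleftrightarrow>
     \<not> (\<exists>p. \<forall>t\<le>D. p t < p (Suc t) \<and> g (p t) \<noteq> g (p (Suc t)))"

text \<open>From \<open>D + 2\<close> mixed levels one gets a chain with \<open>D + 1\<close>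
  changes: any point of the top level ends it, and each of the other \<open>D + 1\<close> levels
  adds one point.\<close>

lemma card_mixed_levels:
  fixes idx :: "real \<Rightarrow> nat"
  assumes "mono idx" "boundedly_alternating D g" "finite V"
    and mixed: "\<And>v. v \<in> V \<Longrightarrow> \<exists>x x'. idx x = v \<and> idx x' = v \<and> g x \<noteq> g x'"
  shows "card V \<le> D + 1"
proof (rule ccontr)
  assume "\<not> card V \<le> D + 1"
  then obtain W where W: "W \<subseteq> V" "card W = D + 2"
    by (metis Suc_eq_plus1 add_2_eq_Suc' not_less_eq_eq obtain_subset_with_card_n)
  with \<open>finite V\<close> have fin: "finite W" by (rule_tac finite_subset)
  define b where "b = Max W"
  have b: "b \<in> W" "\<And>v. v \<in> W \<Longrightarrow> v \<le> b"
    using W fin unfolding b_def by (auto intro!: Max_in)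
  obtain y where y: "idx y = b" using mixed b(1) W by blast
  have "\<exists>p. p (D + 1) = y \<and> (\<forall>t<D + 1. p t < p (Suc t) \<and> g (p t) \<noteq> g (p (Suc t)))"
  proof (rule alternating_chain[OF \<open>mono idx\<close>, of "W - {b}"])
    show "v < idx y" if "v \<in> W - {b}" for v
      using that b y by (auto simp: order_less_le)
    show "\<exists>x x'. idx x = v \<and> idx x' = v \<and> g x \<noteq> g x'" if "v \<in> W - {b}" for v
      using that W by (intro mixed) auto
  qed (use W fin b in auto)
  with assms(2) show False
    by (auto simp: boundedly_alternating_def less_Suc_eq_le)
qed

lemma boundedly_alternating_sections:
  assumes "bounded_alternation D \<C>" "C \<in> \<C>"
  shows "boundedly_alternating D (\<lambda>x. (x, y) \<in> C)"
    and "boundedly_alternating D (\<lambda>y. (x, y) \<in> C)"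
proof -
  have A: "at_most_alternations D C L" if "axis_parallel_line L" for L
    using assms that by (auto simp: bounded_alternation_def)
  have "at_most_alternations D C {p. snd p = y}" "at_most_alternations D C {p. fst p = x}"
    by (rule A, unfold axis_parallel_line_def, blast)+
  note row_col = this[unfolded at_most_alternations_def]
  show "boundedly_alternating D (\<lambda>x. (x, y) \<in> C)"
    unfolding boundedly_alternating_def
  proof
    assume "\<exists>p. \<forall>t\<le>D. p t < p (Suc t) \<and> ((p t, y) \<in> C) \<noteq> ((p (Suc t), y) \<in> C)"
    then obtain p where "\<forall>t\<le>D. p t < p (Suc t) \<and> ((p t, y) \<in> C) \<noteq> ((p (Suc t), y) \<in> C)" ..
    then show False
      using row_col(1) by (auto simp: line_less_def less_le dest!: spec[of _ "\<lambda>t. (p t, y)"])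
  qed
  show "boundedly_alternating D (\<lambda>y. (x, y) \<in> C)"
    unfolding boundedly_alternating_def
  proof
    assume "\<exists>p. \<forall>t\<le>D. p t < p (Suc t) \<and> ((x, p t) \<in> C) \<noteq> ((x, p (Suc t)) \<in> C)"
    then obtain p where "\<forall>t\<le>D. p t < p (Suc t) \<and> ((x, p t) \<in> C) \<noteq> ((x, p (Suc t)) \<in> C)" ..
    then show False
      using row_col(2) by (auto simp: line_less_def less_le dest!: spec[of _ "\<lambda>t. (x, p t)"])
  qed
qed

section \<open>Cuts adapted to a probability measure\<close>

text \<open>Over a half-open interval of mass above \<open>1 / N\<close> the distribution function
  reaches a new multiple \<open>i / N\<close>, so the corresponding quantile lies in the
  interval.\<close>

lemma (in real_distribution) finite_cuts:
  assumes "N > 0"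
  shows "\<exists>S. finite S \<and> card S = N \<and>
           (\<forall>x y. {x<..y} \<inter> S = {} \<longrightarrow> measure M {x<..y} \<le> 1 / real N)"
proof -
  \<comment> \<open>Quantiles; those at which the set is empty are harmless extra points.\<close>
  define q where "q i = Inf {t. real i / real N \<le> cdf M t}" for i :: nat
  define S where "S = q ` {1..N}"
  have S: "measure M {x<..y} \<le> 1 / real N" if "{x<..y} \<inter> S = {}" for x y
  proof (rule ccontr)
    assume neg: "\<not> measure M {x<..y} \<le> 1 / real N"
    then have "x < y"
      by (metis greaterThanAtMost_empty linorder_not_less measure_empty of_nat_0_le_iff
          zero_le_divide_1_iff)
    with neg have gap: "cdf M y > cdf M x + 1 / N"
      by (simp add: cdf_diff_eq[symmetric])
    \<comment> \<open>The least integer strictly above \<open>N * cdf M x\<close>; a gap exceeding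
      \<open>1 / N\<close> leaves \<open>i / N\<close> at most \<open>cdf M y\<close>.\<close>
    define i where "i = Suc (nat \<lfloor>N * cdf M x\<rfloor>)"
    have i: "N * cdf M x < i" "i \<le> N * cdf M x + 1"
      unfolding i_def using cdf_nonneg[of x] by (auto simp: of_nat_nat) linarith+
    have lt: "cdf M x < i / N" and le: "i / N \<le> cdf M y"
      using i gap \<open>N > 0\<close> by (auto simp: field_simps)
    have "i / N \<le> 1" using le cdf_bounded_prob[of y] by linarith
    then have "i \<in> {1..N}" using \<open>N > 0\<close> by (auto simp: i_def field_simps)
    let ?T = "{t. real i / real N \<le> cdf M t}"
    have lower: "x \<le> t" if "t \<in> ?T" for t
      using that lt cdf_nondecreasing[of t x] by force
    have bdd: "bdd_below ?T" using lower by (rule bdd_belowI)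
    have "y \<in> ?T" using le by simp
    have "q i \<le> y" unfolding q_def using bdd \<open>y \<in> ?T\<close> by (rule cInf_lower[rotated])
    have "x \<le> q i" unfolding q_def using \<open>y \<in> ?T\<close> lower by (intro cInf_greatest) auto
    \<comment> \<open>Right continuity shows that the quantile attains its level. This excludes
      \<open>q i = x\<close>, the end point missing from the half-open interval.\<close>
    have "i / N \<le> cdf M (q i)"
    proof (rule tendsto_lowerbound)
      show "(cdf M \<longlongrightarrow> cdf M (q i)) (at_right (q i))"
        using cdf_is_right_cont[of "q i"] by (simp add: continuous_within)
      show "\<forall>\<^sub>F t in at_right (q i). i / N \<le> cdf M t"
      proof (unfold eventually_at_right_field, intro exI[of _ "q i + 1"] conjI allI impI)
        fix t assume "q i < t"
        then obtain s where "s \<in> ?T" "s < t"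
          using cInf_less_iff[OF _ bdd] \<open>y \<in> ?T\<close> unfolding q_def by blast
        then show "i / N \<le> cdf M t"
          using cdf_nondecreasing[of s t] by simp
      qed simp
    qed simp
    with lt have "q i \<noteq> x" by auto
    with \<open>x \<le> q i\<close> \<open>q i \<le> y\<close> \<open>i \<in> {1..N}\<close> that show False
      by (force simp: S_def)
  qed
  have "finite S" "card S \<le> N"
    unfolding S_def using card_image_le[of "{1..N}" q] by auto
  \<comment> \<open>Quantiles may coincide. Padding with arbitrary points gives exactly
    \<open>N\<close> cuts, and extra cuts only leave fewer intervals to bound.\<close>
  obtain A :: "real set" where A: "finite A" "card A = N"
    using infinite_arbitrarily_large[OF infinite_UNIV_char_0] by blast
  have "\<exists>T. S \<subseteq> T \<and> T \<subseteq> S \<union> A \<and> card T = N"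
    using \<open>finite S\<close> \<open>card S \<le> N\<close> A card_mono[of "S \<union> A" A]
    by (intro exists_subset_between) auto
  then obtain T where T: "S \<subseteq> T" "T \<subseteq> S \<union> A" "card T = N" by blast
  moreover have "finite T" using T(2) \<open>finite S\<close> A(1) finite_subset by blast
  ultimately show ?thesis
    using S by (intro exI[of _ T]) blast
qed

text \<open>A class with two points contains no cut. By inner regularity it is enough to bound its
  compact subsets, each of which fits into a half-open interval free of cuts.\<close>

lemma (in real_distribution) measure_cut_level:
  assumes cuts: "\<And>x y. {x<..y} \<inter> a ` {..<k} = {} \<Longrightarrow> measure M {x<..y} \<le> \<delta>"
    and uv: "cut_index a k u = i" "cut_index a k v = i" "u \<noteq> v"
  shows "measure M {x. cut_index a k x = i} \<le> \<delta>"
proof -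
  let ?L = "{x. cut_index a k x = i}"
  have no_cut: "a r \<noteq> x" if "x \<in> ?L" "r < k" for r x
  proof
    assume "a r = x"
    obtain w where "w \<noteq> x" "w \<in> ?L" using uv by (metis mem_Collect_eq)
    then show False
      using that \<open>a r = x\<close> cut_index_strict_mono[of w a r x k] cut_index_strict_mono[of x a r w k]
      by (cases w x rule: linorder_cases) auto
  qed
  have "0 \<le> \<delta>" using cuts[of 0 0] by simp
  have "emeasure M ?L = (SUP K\<in>{K. K \<subseteq> ?L \<and> compact K}. emeasure M K)"
    by (rule inner_regular) (auto simp: emeasure_eq_measure)
  also have "\<dots> \<le> ennreal \<delta>"
  proof (intro SUP_least)
    fix K assume "K \<in> {K. K \<subseteq> ?L \<and> compact K}"
    then have K: "K \<subseteq> ?L" "compact K" by auto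
    show "emeasure M K \<le> ennreal \<delta>"
    proof (cases "K = {}")
      case False
      obtain x y where x: "x \<in> K" "\<And>t. t \<in> K \<Longrightarrow> x \<le> t" and y: "y \<in> K" "\<And>t. t \<in> K \<Longrightarrow> t \<le> y"
        using compact_attains_inf[OF K(2) False] compact_attains_sup[OF K(2) False] by blast
      \<comment> \<open>The interval must contain the minimum \<open>x\<close> of \<open>K\<close>,
        so its open end is moved to some \<open>x'\<close> below \<open>x\<close> but above all cuts
        below \<open>x\<close>. The entry \<open>x - 1\<close> keeps the set under
        \<open>Max\<close> nonempty. A cut in the new interval would then separate \<open>x\<close>
        from \<open>y\<close>.\<close>
      have "Max (insert (x - 1) {s \<in> a ` {..<k}. s < x}) < x"
        by (subst Max_less_iff) auto
      then obtain x' where x': "Max (insert (x - 1) {s \<in> a ` {..<k}. s < x}) < x'" "x' < x"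
        using dense by blast
      then have below: "s < x'" if "s \<in> a ` {..<k}" "s < x" for s
        using that by (subst (asm) Max_less_iff) auto
      have "a r \<notin> {x'<..y}" if "r < k" for r
      proof
        assume r: "a r \<in> {x'<..y}"
        with below that have "x \<le> a r" by force
        moreover have "a r \<noteq> x" using no_cut x(1) K(1) that by blast
        ultimately have "cut_index a k x < cut_index a k y"
          using r that by (intro cut_index_strict_mono[of x a r y k]) auto
        moreover have "cut_index a k x = i" "cut_index a k y = i"
          using x(1) y(1) K(1) by blast+
        ultimately show False by simp
      qed
      then have "measure M {x'<..y} \<le> \<delta>" by (intro cuts) auto
      moreover have "measure M K \<le> measure M {x'<..y}"
        using x y x'(2) by (intro finite_measure_mono) force+
      ultimately show ?thesis
        by (simp add: emeasure_eq_measure ennreal_leI)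
    qed simp
  qed
  finally show ?thesis
    using \<open>0 \<le> \<delta>\<close> by (simp add: emeasure_eq_measure)
qed

section \<open>Error estimates on lines and in the plane\<close>

text \<open>If \<open>g\<close> changes between \<open>x\<close> and its representative, the class
  of \<open>x\<close> is mixed. There are at most \<open>D + 1\<close> mixed classes, and each has
  two distinct points, hence mass at most \<open>\<delta>\<close>.\<close>

lemma measure_change_within_levels:
  fixes M :: "real measure" and idx :: "real \<Rightarrow> nat"
  assumes "borel_prob M" and [measurable]: "idx \<in> borel \<rightarrow>\<^sub>M count_space UNIV"
    and "mono idx" "\<And>x. idx x \<le> n" "boundedly_alternating D g" "0 \<le> \<delta>"
    and level: "\<And>u v. \<lbrakk>idx u = idx v; u \<noteq> v\<rbrakk> \<Longrightarrow> measure M {x. idx x = idx u} \<le> \<delta>"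
    and r: "\<And>x. idx (r x) = idx x"
  shows "measure M {x. g x \<noteq> g (r x)} \<le> real (D + 1) * \<delta>"
proof -
  interpret prob_space M using assms(1) by (simp add: borel_prob_def)
  have sets: "sets M = sets borel" using assms(1) by (simp add: borel_prob_def)
  define V where "V = {v. \<exists>x x'. idx x = v \<and> idx x' = v \<and> g x \<noteq> g x'}"
  have "V \<subseteq> {..n}" using assms(4) by (auto simp: V_def)
  then have "finite V" by (rule finite_subset) simp
  have card: "card V \<le> D + 1"
    using \<open>finite V\<close> by (intro card_mixed_levels[OF assms(3,5)]) (auto simp: V_def)
  have meas: "{x. idx x = v} \<in> sets M" for v
    unfolding sets by measurable
  have "measure M {x. g x \<noteq> g (r x)} \<le> measure M (\<Union>v\<in>V. {x. idx x = v})"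
  proof (rule finite_measure_mono)
    have "idx x \<in> V" if "g x \<noteq> g (r x)" for x
      unfolding V_def using that r[of x] by blast
    then show "{x. g x \<noteq> g (r x)} \<subseteq> (\<Union>v\<in>V. {x. idx x = v})" by auto
    show "(\<Union>v\<in>V. {x. idx x = v}) \<in> sets M"
      using \<open>finite V\<close> meas by (intro sets.finite_UN) auto
  qed
  also have "\<dots> \<le> (\<Sum>v\<in>V. measure M {x. idx x = v})"
    using \<open>finite V\<close> meas by (intro finite_measure_subadditive_finite) auto
  also have "\<dots> \<le> (\<Sum>v\<in>V. \<delta>)"
  proof (rule sum_mono)
    fix v assume "v \<in> V"
    then obtain x x' where "idx x = v" "idx x' = v" "g x \<noteq> g x'" by (auto simp: V_def)
    then show "measure M {x. idx x = v} \<le> \<delta>" using level[of x x'] by auto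
  qed
  also have "\<dots> \<le> real (D + 1) * \<delta>"
    using card \<open>0 \<le> \<delta>\<close> unfolding sum_constant by (intro mult_right_mono) linarith+
  finally show ?thesis .
qed

text \<open>Replace the coordinates by representatives one at a time. \<open>E\<close> is the error
  of the first replacement, bounded along horizontal lines; \<open>F\<close> is that of the second,
  bounded along vertical lines.\<close>

lemma grid_approximation:
  fixes C :: "(real \<times> real) set" and i0 i1 :: "real \<Rightarrow> nat"
  assumes M: "borel_prob M" and N: "borel_prob N" and C: "C \<in> sets borel" and "0 \<le> \<delta>"
    and [measurable]: "i0 \<in> borel \<rightarrow>\<^sub>M count_space UNIV" "i1 \<in> borel \<rightarrow>\<^sub>M count_space UNIV"
    and mono: "mono i0" "mono i1" and le: "\<And>x. i0 x \<le> n" "\<And>y. i1 y \<le> n"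
    and alt: "\<And>y. boundedly_alternating D (\<lambda>x. (x, y) \<in> C)"
      "\<And>x. boundedly_alternating D (\<lambda>y. (x, y) \<in> C)"
    and level: "\<And>u v. \<lbrakk>i0 u = i0 v; u \<noteq> v\<rbrakk> \<Longrightarrow> measure M {x. i0 x = i0 u} \<le> \<delta>"
      "\<And>u v. \<lbrakk>i1 u = i1 v; u \<noteq> v\<rbrakk> \<Longrightarrow> measure N {y. i1 y = i1 u} \<le> \<delta>"
    and r: "\<And>x. i0 (r (i0 x)) = i0 x" "\<And>y. i1 (s (i1 y)) = i1 y"
    and small: "2 * real (D + 1) * \<delta> < \<epsilon>"
  shows "symdiff_less M N {(x, y). (r (i0 x), s (i1 y)) \<in> C} C \<epsilon>"
proof -
  interpret M: prob_space M using M by (simp add: borel_prob_def)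
  interpret N: prob_space N using N by (simp add: borel_prob_def)
  interpret P: pair_prob_space M N ..
  have [measurable_cong]: "sets M = sets borel" "sets N = sets borel"
    using M N by (auto simp: borel_prob_def)
  then have sp: "space M = UNIV" "space N = UNIV"
    by (auto dest: sets_eq_imp_space_eq)
  have [measurable]: "C \<in> sets (borel \<Otimes>\<^sub>M borel)" using C by (subst borel_prod)
  \<comment> \<open>Representatives are chosen per class index, hence are functions on a discrete
    space.\<close>
  have [measurable]: "r \<in> count_space UNIV \<rightarrow>\<^sub>M borel" "s \<in> count_space UNIV \<rightarrow>\<^sub>M borel"
    by auto
  define E where "E = {p \<in> space (M \<Otimes>\<^sub>M N). (p \<in> C) \<noteq> ((r (i0 (fst p)), snd p) \<in> C)}"
  define F where "F = {p \<in> space (M \<Otimes>\<^sub>M N).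
    ((r (i0 (fst p)), snd p) \<in> C) \<noteq> ((r (i0 (fst p)), s (i1 (snd p))) \<in> C)}"
  define A where "A = {p \<in> space (M \<Otimes>\<^sub>M N). (r (i0 (fst p)), s (i1 (snd p))) \<in> C}"
  have meas: "E \<in> sets (M \<Otimes>\<^sub>M N)" "F \<in> sets (M \<Otimes>\<^sub>M N)" "A \<in> sets (M \<Otimes>\<^sub>M N)"
    unfolding E_def F_def A_def by measurable
  let ?c = "ennreal (real (D + 1) * \<delta>)"
  have "emeasure (M \<Otimes>\<^sub>M N) E = (\<integral>\<^sup>+y. emeasure M ((\<lambda>x. (x, y)) -` E) \<partial>N)"
    using meas by (intro P.emeasure_pair_measure_alt2)
  also have "\<dots> \<le> (\<integral>\<^sup>+y. ?c \<partial>N)"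
  proof (rule nn_integral_mono)
    fix y
    have "(\<lambda>x. (x, y)) -` E = {x. ((x, y) \<in> C) \<noteq> ((r (i0 x), y) \<in> C)}"
      by (auto simp: E_def space_pair_measure sp)
    moreover have "measure M {x. ((x, y) \<in> C) \<noteq> ((r (i0 x), y) \<in> C)} \<le> real (D + 1) * \<delta>"
      by (rule measure_change_within_levels[where idx = i0 and r = "\<lambda>x. r (i0 x)",
            OF M assms(5) mono(1) le(1) alt(1) \<open>0 \<le> \<delta>\<close> level(1) r(1)])
    ultimately show "emeasure M ((\<lambda>x. (x, y)) -` E) \<le> ?c"
      by (simp add: M.emeasure_eq_measure ennreal_leI)
  qed
  finally have E: "measure (M \<Otimes>\<^sub>M N) E \<le> real (D + 1) * \<delta>"
    using \<open>0 \<le> \<delta>\<close> by (simp add: N.emeasure_space_1 P.emeasure_eq_measure)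
  have "emeasure (M \<Otimes>\<^sub>M N) F = (\<integral>\<^sup>+x. emeasure N (Pair x -` F) \<partial>M)"
    using meas by (intro N.emeasure_pair_measure_alt)
  also have "\<dots> \<le> (\<integral>\<^sup>+x. ?c \<partial>M)"
  proof (rule nn_integral_mono)
    fix x
    \<comment> \<open>This section is governed by \<open>C\<close> on the vertical line over the
      representative \<open>r (i0 x)\<close>, so the alternation bound is applied there.\<close>
    have "Pair x -` F = {y. ((r (i0 x), y) \<in> C) \<noteq> ((r (i0 x), s (i1 y)) \<in> C)}"
      by (auto simp: F_def space_pair_measure sp)
    moreover have "measure N {y. ((r (i0 x), y) \<in> C) \<noteq> ((r (i0 x), s (i1 y)) \<in> C)} \<le> real (D + 1) * \<delta>"
      by (rule measure_change_within_levels[where idx = i1 and r = "\<lambda>y. s (i1 y)",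
            OF N assms(6) mono(2) le(2) alt(2) \<open>0 \<le> \<delta>\<close> level(2) r(2)])
    ultimately show "emeasure N (Pair x -` F) \<le> ?c"
      by (simp add: N.emeasure_eq_measure ennreal_leI)
  qed
  finally have F: "measure (M \<Otimes>\<^sub>M N) F \<le> real (D + 1) * \<delta>"
    using \<open>0 \<le> \<delta>\<close> by (simp add: M.emeasure_space_1 P.emeasure_eq_measure)
  have A: "{(x, y). (r (i0 x), s (i1 y)) \<in> C} = A"
    by (auto simp: A_def space_pair_measure sp)
  have "C \<in> sets (M \<Otimes>\<^sub>M N)" by measurable
  with meas have sd: "sym_diff A C \<in> sets (M \<Otimes>\<^sub>M N)" by auto
  \<comment> \<open>If neither replacement changes membership in \<open>C\<close>, the point is not
    in the symmetric difference.\<close>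
  have "measure (M \<Otimes>\<^sub>M N) (sym_diff A C) \<le> measure (M \<Otimes>\<^sub>M N) (E \<union> F)"
    using meas by (intro P.finite_measure_mono) (auto simp: A_def E_def F_def space_pair_measure sp)
  also have "\<dots> \<le> measure (M \<Otimes>\<^sub>M N) E + measure (M \<Otimes>\<^sub>M N) F"
    using meas by (intro measure_Un_le)
  also have "\<dots> < \<epsilon>" using E F small by (simp add: algebra_simps)
  finally show ?thesis
    using sd unfolding symdiff_less_def A by simp
qed

section \<open>The defining formula\<close>

definition FConj :: "oform list \<Rightarrow> oform" where
  "FConj ps = foldr FAnd ps (FEq TZero TZero)"

definition FDisj :: "oform list \<Rightarrow> oform" where
  "FDisj ps = FNot (FConj (map FNot ps))"

lemma sat_FConj [simp]: "sat e (FConj ps) \<longleftrightarrow> (\<forall>p\<in>set ps. sat e p)"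
  unfolding FConj_def by (induction ps) auto

lemma sat_FDisj [simp]: "sat e (FDisj ps) \<longleftrightarrow> (\<exists>p\<in>set ps. sat e p)"
  by (simp add: FDisj_def)

lemma fvars_FConj [simp]: "fvars (FConj ps) = (\<Union>p\<in>set ps. fvars p)"
  unfolding FConj_def by (induction ps) auto

lemma fvars_FDisj [simp]: "fvars (FDisj ps) = (\<Union>p\<in>set ps. fvars p)"
  by (simp add: FDisj_def)

lemma sat_FConj_upt: "sat e (FConj (map f [0..<n])) \<longleftrightarrow> (\<forall>i<n. sat e (f i))"
  by auto

text \<open>\<open>v\<close> is the variable to be located; the cuts are the \<open>k\<close>
  parameters starting at variable \<open>off\<close>.\<close>

definition pattern_form :: "nat \<Rightarrow> nat \<Rightarrow> nat \<Rightarrow> nat \<Rightarrow> oform" where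
  "pattern_form k v off i = FConj (map (\<lambda>r.
     if 2 * r + 1 < i then FLess (TVar (off + r)) (TVar v)
     else if 2 * r + 1 = i then FEq (TVar v) (TVar (off + r))
     else FLess (TVar v) (TVar (off + r))) [0..<k])"

lemma sat_pattern_form:
  "sat e (pattern_form k v off i) \<longleftrightarrow> cut_pattern (\<lambda>r. e (off + r)) k i (e v)"
proof -
  have "sat e (pattern_form k v off i) \<longleftrightarrow> (\<forall>r<k. sat e
      (if 2 * r + 1 < i then FLess (TVar (off + r)) (TVar v)
       else if 2 * r + 1 = i then FEq (TVar v) (TVar (off + r))
       else FLess (TVar v) (TVar (off + r))))"
    unfolding pattern_form_def sat_FConj_upt ..
  then show ?thesis
    by (simp add: cut_pattern_def if_distrib[of "sat e"])
qed

lemma fvars_pattern_form: "fvars (pattern_form k v off i) \<subseteq> insert v {off..<off + k}"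
  by (auto simp: pattern_form_def split: if_splits)

text \<open>There are \<open>2 * k + 1\<close> classes per axis, and \<open>w\<close> holds one bit per pair of classes. So \<open>m\<close> will be
  \<open>2 * k + 1\<close>, and only the first \<open>k\<close> of the \<open>m\<close> grid coordinates on each axis are used as cuts.\<close>

definition grid_form :: "nat \<Rightarrow> nat \<Rightarrow> oform" where
  "grid_form k m = FDisj (map (\<lambda>n. FConj
     [pattern_form k 0 2 (n div m), pattern_form k 1 (2 + m) (n mod m),
      FEq (TVar (2 + 2 * m + n)) TOne]) [0..<m ^ 2])"

lemma formula_in_grid_form:
  assumes "k \<le> m"
  shows "formula_in (2 * m) (m ^ 2) (grid_form k m)"
proof -
  have "fvars (pattern_form k 0 2 i) \<subseteq> {..<2 + 2 * m + m ^ 2}"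
    "fvars (pattern_form k 1 (2 + m) i) \<subseteq> {..<2 + 2 * m + m ^ 2}" for i
    using fvars_pattern_form[of k 0 2 i] fvars_pattern_form[of k 1 "2 + m" i] assms by fastforce+
  then show ?thesis
    by (auto simp: formula_in_def grid_form_def)
qed

text \<open>With \<open>m = 2 * k + 1\<close>, the numbers below \<open>m ^ 2\<close> code exactly
  the pairs of class indices, through quotient and remainder. Only the disjunct of the pair
  containing \<open>(x, y)\<close> can hold, and its bit decides.\<close>

lemma defset_grid_form:
  assumes "strict_mono_on {..<k} a" "strict_mono_on {..<k} b"
  defines "m \<equiv> 2 * k + 1"
  shows "defset (grid_form k m) (map a [0..<m] @ map b [0..<m])
      (map (\<lambda>n. if Q (n div m) (n mod m) then 1 else 0) [0..<m ^ 2]) =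
    {(x, y). Q (cut_index a k x) (cut_index b k y)}"
proof -
  let ?ws = "map (\<lambda>n. if Q (n div m) (n mod m) then 1 else 0) [0..<m ^ 2] :: real list"
  have "sat (assign (x # y # (map a [0..<m] @ map b [0..<m]) @ ?ws)) (grid_form k m) \<longleftrightarrow>
      Q (cut_index a k x) (cut_index b k y)" for x y
  proof -
    define e where "e = assign (x # y # (map a [0..<m] @ map b [0..<m]) @ ?ws)"
    have vars: "e 0 = x" "e 1 = y" "\<And>r. r < k \<Longrightarrow> e (2 + r) = a r"
      "\<And>r. r < k \<Longrightarrow> e (2 + m + r) = b r"
      "\<And>n. n < m ^ 2 \<Longrightarrow> e (2 + 2 * m + n) = (if Q (n div m) (n mod m) then 1 else 0)"
      by (auto simp: e_def assign_def nth_append m_def)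
    have p: "sat e (pattern_form k 0 2 i) \<longleftrightarrow> cut_pattern a k i x"
      "sat e (pattern_form k 1 (2 + m) i) \<longleftrightarrow> cut_pattern b k i y" for i
      using vars by (auto simp: sat_pattern_form cut_pattern_def)
    have small: "n div m \<le> 2 * k" "n mod m \<le> 2 * k" if "n < m ^ 2" for n
      using that less_mult_imp_div_less[of n m m] mod_less_divisor[of m n]
      by (auto simp: m_def power2_eq_square)
    have "sat e (grid_form k m) \<longleftrightarrow>
        (\<exists>n<m ^ 2. cut_index a k x = n div m \<and> cut_index b k y = n mod m \<and> Q (n div m) (n mod m))"
    proof -
      have "sat e (grid_form k m) \<longleftrightarrow> (\<exists>n<m ^ 2. cut_pattern a k (n div m) x \<and>
          cut_pattern b k (n mod m) y \<and> e (2 + 2 * m + n) = 1)"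
        unfolding grid_form_def p[symmetric] by (auto simp: Bex_def)
      moreover have "cut_pattern a k (n div m) x \<and> cut_pattern b k (n mod m) y \<and>
          e (2 + 2 * m + n) = 1 \<longleftrightarrow>
          cut_index a k x = n div m \<and> cut_index b k y = n mod m \<and> Q (n div m) (n mod m)"
        if "n < m ^ 2" for n
        using vars(5)[OF that] cut_pattern_iff[OF assms(1) small(1)[OF that]]
          cut_pattern_iff[OF assms(2) small(2)[OF that]] by simp
      ultimately show ?thesis by blast
    qed
    also have "\<dots> \<longleftrightarrow> Q (cut_index a k x) (cut_index b k y)"
    proof
      assume Q: "Q (cut_index a k x) (cut_index b k y)"
      \<comment> \<open>The code of the pair of classes of \<open>x\<close> and \<open>y\<close>;
        both indices being below \<open>m\<close>, division recovers them.\<close>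
      let ?n = "cut_index a k x * m + cut_index b k y"
      have lt: "cut_index a k x < m" "cut_index b k y < m"
        using cut_index_le[OF assms(1), of x] cut_index_le[OF assms(2), of y] by (auto simp: m_def)
      then have "?n < (cut_index a k x + 1) * m" by simp
      also have "\<dots> \<le> m * m" using lt by (intro mult_right_mono) auto
      finally show "\<exists>n<m ^ 2. cut_index a k x = n div m \<and> cut_index b k y = n mod m \<and> Q (n div m) (n mod m)"
        using lt Q by (intro exI[of _ ?n]) (simp add: power2_eq_square)
    qed auto
    finally show ?thesis unfolding e_def .
  qed
  then show ?thesis by (auto simp: defset_def)
qed

section \<open>Choice of the grid and conclusion\<close>

lemma borel_prob_cuts:
  assumes "borel_prob M" "k > 0"
  obtains a where "strict_mono_on {..<k} a" "inj a"
    "\<And>u v. \<lbrakk>cut_index a k u = cut_index a k v; u \<noteq> v\<rbrakk>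
       \<Longrightarrow> measure M {x. cut_index a k x = cut_index a k u} \<le> 1 / real k"
proof -
  interpret prob_space M using assms by (simp add: borel_prob_def)
  interpret real_distribution M
    using assms by unfold_locales (auto simp: borel_prob_def dest: sets_eq_imp_space_eq)
  obtain S where S: "finite S" "card S = k"
    "\<And>x y. {x<..y} \<inter> S = {} \<Longrightarrow> measure M {x<..y} \<le> 1 / real k"
    using finite_cuts[OF assms(2)] by blast
  define h where "h = (!) (sorted_list_of_set S)"
  have h: "bij_betw h {..<k} S" "strict_mono_on {..<k} h"
    using S(1,2) sorted_wrt_nth_less[OF strict_sorted_list_of_set[of S]] unfolding h_def
    by (auto intro!: bij_betw_nth strict_mono_onI)
  \<comment> \<open>The first \<open>k\<close> values are the sorted cuts. Later ones lie above all
    cuts and only supply further distinct grid coordinates.\<close>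
  define a where "a r = (if r < k then h r else Max S + 1 + r)" for r
  have img: "a ` {..<k} = S"
    using h(1) by (auto simp: a_def bij_betw_def)
  have mono: "strict_mono_on {..<k} a"
    using h(2) by (auto simp: a_def strict_mono_on_def)
  have "strict_mono a"
  proof (rule strict_monoI)
    fix i j :: nat assume "i < j"
    have "h i \<le> Max S" if "i < k"
      using that h(1) S(1) by (auto simp: bij_betw_def intro!: Max_ge)
    with \<open>i < j\<close> strict_mono_onD[OF h(2), of i j] show "a i < a j"
      by (auto simp: a_def)
  qed
  then have "inj a" by (rule strict_mono_imp_inj_on)
  with mono show thesis
    by (rule that) (rule measure_cut_level, use S(3) img in auto)
qed

theorem theorem5p2:
  fixes D :: nat and \<epsilon> :: real
  assumes "\<epsilon> > 0"
  shows "\<exists>(\<phi> :: oform) (m :: nat). formula_in (2 * m) (m ^ 2) \<phi> \<and>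
    (\<forall>\<C> :: (real \<times> real) set set.
      (\<forall>C\<in>\<C>. C \<in> sets borel) \<and> bounded_alternation D \<C> \<longrightarrow>
      (\<forall>\<mu>\<^sub>0 \<mu>\<^sub>1. borel_prob \<mu>\<^sub>0 \<and> borel_prob \<mu>\<^sub>1 \<longrightarrow>
        (\<forall>C\<in>\<C>. \<exists>zs ws. length zs = 2 * m \<and> length ws = m ^ 2 \<and>
           symdiff_less \<mu>\<^sub>0 \<mu>\<^sub>1 (defset \<phi> zs ws) C \<epsilon>) \<and>
        (\<exists>\<Gamma> a b. is_grid m a b \<Gamma> \<and>
           (\<forall>C\<in>\<C>. \<exists>ws. length ws = m ^ 2 \<and> set ws \<subseteq> {0, 1} \<and>
              symdiff_less \<mu>\<^sub>0 \<mu>\<^sub>1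
                (defset \<phi> (map a [0..<m] @ map b [0..<m]) ws) C \<epsilon>))))"
proof -
  \<comment> \<open>\<open>k\<close> makes the total error \<open>2 * (D + 1) / k\<close> smaller
    than \<open>\<epsilon>\<close>. It depends on \<open>D\<close> and \<open>\<epsilon>\<close>
    alone, so the formula is fixed before the family and the measures.\<close>
  obtain k :: nat where k: "2 * (D + 1) / \<epsilon> < k"
    using reals_Archimedean2 by blast
  moreover have "0 < 2 * (D + 1) / \<epsilon>" using assms by simp
  ultimately have "k > 0" by (metis less_trans of_nat_0_less_iff)
  have small: "2 * real (D + 1) * (1 / real k) < \<epsilon>"
    using k assms \<open>k > 0\<close> by (simp add: field_simps)
  define m where "m = 2 * k + 1"
  have main: "\<exists>\<Gamma> a b. is_grid m a b \<Gamma> \<and>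
      (\<forall>C\<in>\<C>. \<exists>ws. length ws = m ^ 2 \<and> set ws \<subseteq> {0, 1} \<and>
         symdiff_less M N (defset (grid_form k m) (map a [0..<m] @ map b [0..<m]) ws) C \<epsilon>)"
    if \<C>: "\<forall>C\<in>\<C>. C \<in> sets borel" "bounded_alternation D \<C>" and M: "borel_prob M" and N: "borel_prob N"
    for \<C> M N
  proof -
    from M \<open>k > 0\<close> obtain a where a: "strict_mono_on {..<k} a" "inj a"
      "\<And>u v. \<lbrakk>cut_index a k u = cut_index a k v; u \<noteq> v\<rbrakk>
         \<Longrightarrow> measure M {x. cut_index a k x = cut_index a k u} \<le> 1 / real k"
      by (rule borel_prob_cuts) blast
    from N \<open>k > 0\<close> obtain b where b: "strict_mono_on {..<k} b" "inj b"
      "\<And>u v. \<lbrakk>cut_index b k u = cut_index b k v; u \<noteq> v\<rbrakk>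
         \<Longrightarrow> measure N {x. cut_index b k x = cut_index b k u} \<le> 1 / real k"
      by (rule borel_prob_cuts) blast
    \<comment> \<open>The values are arbitrary at indices that are not attained; \<open>rs\<close>
      concerns attained ones only.\<close>
    define r where "r i = (SOME x. cut_index a k x = i)" for i
    define s where "s i = (SOME x. cut_index b k x = i)" for i
    have rs: "cut_index a k (r (cut_index a k x)) = cut_index a k x"
      "cut_index b k (s (cut_index b k x)) = cut_index b k x" for x
      unfolding r_def s_def by (rule someI, rule refl)+
    have "symdiff_less M N {(x, y). (r (cut_index a k x), s (cut_index b k y)) \<in> C} C \<epsilon>"
      if "C \<in> \<C>" for C
      using M N \<C>(1) that \<open>k > 0\<close> small
      by (intro grid_approximation[where \<delta> = "1 / real k" and n = "2 * k" and D = D]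
          boundedly_alternating_sections[OF \<C>(2) that] mono_cut_index
          cut_index_le a b rs borel_measurable_cut_index) auto
    note approx = this
    have "\<forall>C\<in>\<C>. \<exists>ws. length ws = m ^ 2 \<and> set ws \<subseteq> {0, 1} \<and>
        symdiff_less M N (defset (grid_form k m) (map a [0..<m] @ map b [0..<m]) ws) C \<epsilon>"
    proof
      fix C assume "C \<in> \<C>"
      \<comment> \<open>The bit of a pair of classes records whether its representative point lies
        in \<open>C\<close>; only these bits depend on \<open>C\<close>.\<close>
      let ?ws = "map (\<lambda>n. if (r (n div m), s (n mod m)) \<in> C then 1 else 0) [0..<m ^ 2] :: real list"
      have "symdiff_less M N (defset (grid_form k m) (map a [0..<m] @ map b [0..<m]) ?ws) C \<epsilon>"
        using approx[OF \<open>C \<in> \<C>\<close>]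
          defset_grid_form[OF a(1) b(1), where Q = "\<lambda>i j. (r i, s j) \<in> C"]
        by (simp add: m_def)
      then show "\<exists>ws. length ws = m ^ 2 \<and> set ws \<subseteq> {0, 1} \<and>
          symdiff_less M N (defset (grid_form k m) (map a [0..<m] @ map b [0..<m]) ws) C \<epsilon>"
        by (intro exI[of _ ?ws]) auto
    qed
    moreover have "is_grid m a b {(a i, b j) | i j. i < m \<and> j < m}"
      using a(2) b(2) by (auto simp: is_grid_def intro: inj_on_subset)
    ultimately show ?thesis by blast
  qed
  have "formula_in (2 * m) (m ^ 2) (grid_form k m)"
    by (rule formula_in_grid_form) (simp add: m_def)
  then show ?thesis
  proof (intro exI[of _ "grid_form k m"] exI[of _ m] conjI allI impI ballI)
    fix \<C> :: "(real \<times> real) set set" and M N C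
    assume *: "(\<forall>C\<in>\<C>. C \<in> sets borel) \<and> bounded_alternation D \<C>"
      "borel_prob M \<and> borel_prob N"
    then show grid: "\<exists>\<Gamma> a b. is_grid m a b \<Gamma> \<and>
      (\<forall>C\<in>\<C>. \<exists>ws. length ws = m ^ 2 \<and> set ws \<subseteq> {0, 1} \<and>
         symdiff_less M N (defset (grid_form k m) (map a [0..<m] @ map b [0..<m]) ws) C \<epsilon>)"
      by (intro main) auto
    assume "C \<in> \<C>"
    \<comment> \<open>The first claim follows from the grid claim, with the grid coordinates as
      \<open>zs\<close>.\<close>
    with grid obtain a b ws where "length ws = m ^ 2"
      "symdiff_less M N (defset (grid_form k m) (map a [0..<m] @ map b [0..<m]) ws) C \<epsilon>"
      by blast
    then show "\<exists>zs ws. length zs = 2 * m \<and> length ws = m ^ 2 \<and>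
        symdiff_less M N (defset (grid_form k m) zs ws) C \<epsilon>"
      by (intro exI[of _ "map a [0..<m] @ map b [0..<m]"] exI[of _ ws]) simp
  qed
qed

end
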